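(* Let $f:\mathbb{R}^d\to\mathbb{R}$ be continuous with a unique global minimizer $x^*$ and $\underline f:=f(x^* )=\min f=0$, and assume there exist $f_\infty,R_0,\eta>0$ and $\nu\in(0,\infty)$ such that $(f(x)-\underline f)^\nu\ge\eta|x-x^*|$ for every $x\in B_{R_0}(x^* )$ and $f(x)\ge\underline f+f_\infty$ for every $x\notin B_{R_0}(x^* )$. Let $\alpha>0$, and for $r>0$ let $f_r:=\sup_{x\in B_r(x^* )}f(x)$. Let $\rho$ be a probability measure on $\mathbb{R}^d$. Then, for every $r\in(0,R_0]$ (with $\rho(B_r(x^* ))>0$), every $0<q<f_\infty-f_r$, and every $v\in\mathbb S^{d-1}$, $$v^\top(X^\alpha(\rho)-x^* )\le\frac{(q+f_r)^\nu}{\eta}+\frac{e^{-\alpha q}}{\rho(B_r(x^* ))}\,\mathbb E_\rho\Big[\big(v^\top(x-x^* )\big)^+\Big],$$ where $y^+=\max\{0,y\}$. In particular, $$|X^\alpha(\rho)-x^*|\le\frac{(q+f_r)^\nu}{\eta}+\frac{e^{-\alpha q}}{\rho(B_r(x^* ))}\sup_{v\in\mathbb S^{d-1}}\mathbb E_\rho\Big[\big(v^\top(x-x^* )\big)^+\Big].$$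
   Context: For a probability measure $\rho$ on $\mathbb{R}^d$ (for which the integrals are finite) and $\alpha>0$, the consensus point is $X^\alpha(\rho)=\frac{\int x e^{-\alpha f(x)}d\rho(x)}{\int e^{-\alpha f(x)}d\rho(x)}$. $\mathbb S^{d-1}$ is the unit sphere. *)

theory Defs
  imports "HOL-Probability.Probability"
begin

definition consensus_point ::
  "real \<Rightarrow> ('a::euclidean_space \<Rightarrow> real) \<Rightarrow> 'a measure \<Rightarrow> 'a" where
  "consensus_point \<alpha> f \<rho> =
     (\<integral>x. exp (- \<alpha> * f x) *\<^sub>R x \<partial>\<rho>) /\<^sub>R (\<integral>x. exp (- \<alpha> * f x) \<partial>\<rho>)"

(* Balls are closed. For continuous f this is the stronger reading: both growth hypotheses are
   the same for open and closed balls, the supremum below does not change, and the measure of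
   the ball, which occurs in the denominator of the bound, can only increase. *)
definition ball_sup :: "('a::euclidean_space \<Rightarrow> real) \<Rightarrow> 'a \<Rightarrow> real \<Rightarrow> real" where
  "ball_sup f z r = (SUP x\<in>cball z r. f x)"

(* The expectation of the positive part of v . (x - z). It is extended-real valued: rho need not
   have a first moment, and the Bochner integral would be 0 where the expectation is infinite. *)
definition expect_pos_part :: "'a::euclidean_space measure \<Rightarrow> 'a \<Rightarrow> 'a \<Rightarrow> ereal" where
  "expect_pos_part \<rho> z v = enn2ereal (\<integral>\<^sup>+x. ennreal (max 0 (v \<bullet> (x - z))) \<partial>\<rho>)"

end

theory Submission
  imports Defs
begin

text \<open>Quantitative Laplace principle: outside the sublevel set of $q + f_r$ the Gibbs weight
  $e^{-\alpha f}$ is at most $e^{-\alpha (q + f_r)}$, whereas the normalising constant is at least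
  $\rho(B_r)\, e^{-\alpha f_r}$. Inside the sublevel set, which is contained in $B_{R_0}$, the growth
  condition bounds the distance to the minimizer by $(q + f_r)^\nu / \eta$.\<close>

lemma le_ball_sup:
  assumes "continuous_on UNIV f" "x \<in> cball z r"
  shows "f x \<le> ball_sup f z r"
proof -
  \<comment> \<open>A real-valued supremum bounds its members only when the image is bounded above;
    compactness of the closed ball supplies this.\<close>
  have "compact (f ` cball z r)"
    using assms(1) by (meson compact_cball compact_continuous_image continuous_on_subset subset_UNIV)
  then show ?thesis
    unfolding ball_sup_def using assms(2)
    by (intro cSUP_upper) (auto intro: bounded_imp_bdd_above compact_imp_bounded)
qed

text \<open>By linearity, testing against \<open>v\<close> turns the vector-valued quotient into a
  weighted average of \<open>v \<bullet> (x - z)\<close>, whose integrand can be estimated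
  pointwise. A nonzero denominator is what allows \<open>z\<close> to be absorbed into the
  numerator.\<close>

lemma inner_consensus_point:
  assumes "integrable \<rho> (\<lambda>x. exp (- \<alpha> * f x) *\<^sub>R x)"
    and "integrable \<rho> (\<lambda>x. exp (- \<alpha> * f x))"
    and "(\<integral>x. exp (- \<alpha> * f x) \<partial>\<rho>) > 0"
  shows "integrable \<rho> (\<lambda>x. exp (- \<alpha> * f x) * (v \<bullet> (x - z)))"
    and "v \<bullet> (consensus_point \<alpha> f \<rho> - z)
      = (\<integral>x. exp (- \<alpha> * f x) * (v \<bullet> (x - z)) \<partial>\<rho>) / (\<integral>x. exp (- \<alpha> * f x) \<partial>\<rho>)"
proof -
  let ?w = "\<lambda>x. exp (- \<alpha> * f x)"
  have eq: "?w x * (v \<bullet> (x - z)) = v \<bullet> (?w x *\<^sub>R x) - ?w x * (v \<bullet> z)" for x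
    by (simp add: inner_diff_right algebra_simps)
  have int: "integrable \<rho> (\<lambda>x. v \<bullet> (?w x *\<^sub>R x))" "integrable \<rho> (\<lambda>x. ?w x * (v \<bullet> z))"
    by (rule integrable_inner_right, rule assms(1)) (rule integrable_mult_left, rule assms(2))
  show "integrable \<rho> (\<lambda>x. ?w x * (v \<bullet> (x - z)))"
    unfolding eq using int by (rule Bochner_Integration.integrable_diff)
  have "(\<integral>x. ?w x * (v \<bullet> (x - z)) \<partial>\<rho>) = v \<bullet> (\<integral>x. ?w x *\<^sub>R x \<partial>\<rho>) - (\<integral>x. ?w x \<partial>\<rho>) * (v \<bullet> z)"
    unfolding eq Bochner_Integration.integral_diff[OF int]
    using assms(1,2) by (simp del: inner_scaleR_right)
  then show "v \<bullet> (consensus_point \<alpha> f \<rho> - z)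
      = (\<integral>x. ?w x * (v \<bullet> (x - z)) \<partial>\<rho>) / (\<integral>x. ?w x \<partial>\<rho>)"
    using assms(3) by (simp add: consensus_point_def inner_diff_right field_simps)
qed

text \<open>Discard the mass off the ball, where the weight is positive, and replace the weight on
  the ball by its lower bound there.\<close>

lemma gibbs_mass_ge:
  assumes "continuous_on UNIV f" "\<alpha> \<ge> 0" "sets \<rho> = sets borel" "finite_measure \<rho>"
    and "integrable \<rho> (\<lambda>x. exp (- \<alpha> * f x))"
  shows "measure \<rho> (cball z r) * exp (- \<alpha> * ball_sup f z r) \<le> (\<integral>x. exp (- \<alpha> * f x) \<partial>\<rho>)"
proof -
  interpret finite_measure \<rho> by fact
  let ?c = "exp (- \<alpha> * ball_sup f z r)"
  have meas: "cball z r \<in> sets \<rho>" using assms(3) by simp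
  have "measure \<rho> (cball z r) * ?c = (\<integral>x. indicator (cball z r) x * ?c \<partial>\<rho>)"
    using meas by simp
  also have "\<dots> \<le> (\<integral>x. exp (- \<alpha> * f x) \<partial>\<rho>)"
  proof (rule integral_mono)
    show "integrable \<rho> (\<lambda>x. indicator (cball z r) x * ?c)"
      by (intro integrable_mult_left integrable_real_indicator meas) (simp add: less_top[symmetric])
    show "indicator (cball z r) x * ?c \<le> exp (- \<alpha> * f x)" for x
      using le_ball_sup[OF assms(1), of x z r] assms(2)
      by (auto simp: indicator_def mult_left_mono)
  qed (fact assms(5))
  finally show ?thesis .
qed

lemma expect_pos_part_nonneg: "0 \<le> expect_pos_part \<rho> z v"
  by (simp add: expect_pos_part_def)

theorem lemma4p3:
  fixes f :: "real ^ 'd \<Rightarrow> real" and xs :: "real ^ 'd"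
    and f_inf R0 \<eta> \<nu> \<alpha> r q :: real and \<rho> :: "(real ^ 'd) measure"
  assumes cont: "continuous_on UNIV f"
    and minimizer: "\<forall>x. is_arg_min f (\<lambda>_. True) x \<longleftrightarrow> x = xs"
    and min_zero: "f xs = 0"
    and pos: "f_inf > 0" "R0 > 0" "\<eta> > 0" "\<nu> > 0"
    and growth_in: "\<forall>x\<in>cball xs R0. (f x - f xs) powr \<nu> \<ge> \<eta> * norm (x - xs)"
    and growth_out: "\<forall>x. x \<notin> cball xs R0 \<longrightarrow> f x \<ge> f xs + f_inf"
    and alpha: "\<alpha> > 0"
    and prob: "prob_space \<rho>" and borel: "sets \<rho> = sets borel"
    and fin_num: "integrable \<rho> (\<lambda>x. exp (- \<alpha> * f x) *\<^sub>R x)"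
    and fin_den: "integrable \<rho> (\<lambda>x. exp (- \<alpha> * f x))"
    and r: "0 < r" "r \<le> R0" "measure \<rho> (cball xs r) > 0"
    and q: "0 < q" "q < f_inf - ball_sup f xs r"
  shows "(\<forall>v\<in>sphere 0 1.
            ereal (v \<bullet> (consensus_point \<alpha> f \<rho> - xs))
              \<le> ereal ((q + ball_sup f xs r) powr \<nu> / \<eta>)
                + ereal (exp (- \<alpha> * q) / measure \<rho> (cball xs r)) * expect_pos_part \<rho> xs v)
       \<and> ereal (norm (consensus_point \<alpha> f \<rho> - xs))
              \<le> ereal ((q + ball_sup f xs r) powr \<nu> / \<eta>)
                + ereal (exp (- \<alpha> * q) / measure \<rho> (cball xs r))
                  * (SUP v\<in>sphere 0 1. expect_pos_part \<rho> xs v)"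
proof -
  interpret prob_space \<rho> by (fact prob)
  let ?w = "\<lambda>x. exp (- \<alpha> * f x)" and ?X = "consensus_point \<alpha> f \<rho>"
  define F where "F = ball_sup f xs r"
  define m where "m = measure \<rho> (cball xs r)"
  define Z where "Z = (\<integral>x. ?w x \<partial>\<rho>)"
  define C where "C = (q + F) powr \<nu> / \<eta>"
  define K where "K = exp (- \<alpha> * q) / m"
  have m: "m > 0" using r by (simp add: m_def)
  have K: "K > 0" using m by (simp add: K_def)
  have C: "C \<ge> 0" using pos by (simp add: C_def)
  have Z_ge: "m * exp (- \<alpha> * F) \<le> Z"
    using gibbs_mass_ge[OF cont _ borel _ fin_den] alpha finite_measure_axioms
    by (simp add: m_def F_def Z_def)
  have Z: "Z > 0" using Z_ge m by (smt (verit) mult_pos_pos exp_gt_zero)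
  \<comment> \<open>Monotonicity of \<open>powr\<close> in its base, used in \<open>norm_le\<close>,
    requires a nonnegative base.\<close>
  have f_nonneg: "f x \<ge> 0" for x
    using minimizer min_zero by (metis is_arg_min_linorder)
  have norm_le: "norm (x - xs) \<le> C" if "f x \<le> q + F" for x
  proof -
    \<comment> \<open>Since \<open>q + F < f_inf\<close>, a point outside this ball would have too
      large a value of \<open>f\<close>.\<close>
    have "x \<in> cball xs R0"
      using growth_out min_zero q that by (force simp: F_def)
    then have "\<eta> * norm (x - xs) \<le> f x powr \<nu>"
      using growth_in min_zero by force
    also have "\<dots> \<le> (q + F) powr \<nu>"
      using f_nonneg that pos by (intro powr_mono2) auto
    finally show ?thesis using pos by (simp add: C_def field_simps)
  qed
  have main: "ereal (v \<bullet> (?X - xs)) \<le> ereal C + ereal K * expect_pos_part \<rho> xs v"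
    if v: "norm v = 1" for v
  proof -
    let ?p = "\<lambda>x. max 0 (v \<bullet> (x - xs))" and ?g = "\<lambda>x. ?w x * (v \<bullet> (x - xs))"
    have p_meas: "?p \<in> borel_measurable \<rho>"
      unfolding measurable_cong_sets[OF borel refl] by measurable
    show ?thesis
    \<comment> \<open>If the expectation is infinite, so is the right-hand side, because
      \<open>K\<close> is strictly positive. Otherwise \<open>?p\<close> is integrable and the whole
      estimate takes place in the reals.\<close>
    proof (cases "(\<integral>\<^sup>+x. ennreal (?p x) \<partial>\<rho>) = \<infinity>")
      case True
      then show ?thesis using K by (simp add: expect_pos_part_def)
    next
      case False
      then have p_int: "integrable \<rho> ?p"
        using p_meas by (intro integrableI_nonneg) (auto simp: top.not_eq_extremum)
      have E: "expect_pos_part \<rho> xs v = ereal (\<integral>x. ?p x \<partial>\<rho>)"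
        unfolding expect_pos_part_def
        by (subst nn_integral_eq_integral[OF p_int]) (auto simp: enn2ereal_ennreal)
      \<comment> \<open>Both summands are nonnegative, and each covers one side of the sublevel set:
        the first by Cauchy-Schwarz with a unit \<open>v\<close>, the second by the decay of the
        weight. Keeping \<open>?w x\<close> in the first makes it integrate to \<open>C * Z\<close>,
        which is exactly \<open>C\<close> after normalisation.\<close>
      have pointwise: "?g x \<le> C * ?w x + exp (- \<alpha> * (q + F)) * ?p x" for x
      proof (cases "f x \<le> q + F")
        case True
        have "v \<bullet> (x - xs) \<le> C"
          using norm_cauchy_schwarz[of v "x - xs"] norm_le[OF True] v by simp
        then show ?thesis by (simp add: mult.commute add_increasing2)
      next
        case False
        then have "?w x \<le> exp (- \<alpha> * (q + F))" using alpha by simp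
        then have "?w x * ?p x \<le> exp (- \<alpha> * (q + F)) * ?p x" by (rule mult_right_mono) simp
        moreover have "?g x \<le> ?w x * ?p x" by simp
        moreover have "0 \<le> C * ?w x" using C by simp
        ultimately show ?thesis by linarith
      qed
      note X = inner_consensus_point[OF fin_num fin_den Z[unfolded Z_def], of v xs, folded Z_def]
      have "(\<integral>x. ?g x \<partial>\<rho>) \<le> (\<integral>x. C * ?w x + exp (- \<alpha> * (q + F)) * ?p x \<partial>\<rho>)"
        using X(1) fin_den p_int pointwise
        by (intro integral_mono Bochner_Integration.integrable_add integrable_mult_right)
      also have "\<dots> = C * Z + exp (- \<alpha> * (q + F)) * (\<integral>x. ?p x \<partial>\<rho>)"
        using fin_den p_int by (simp add: Z_def)
      \<comment> \<open>This splits off the lower bound \<open>m * exp (- \<alpha> * F)\<close> for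
        \<open>Z\<close>, so that the second term also acquires a factor \<open>Z\<close> and the
        division cancels it.\<close>
      also have "exp (- \<alpha> * (q + F)) = K * (m * exp (- \<alpha> * F))"
        using m by (simp add: K_def exp_add[symmetric] algebra_simps)
      also have "C * Z + K * (m * exp (- \<alpha> * F)) * (\<integral>x. ?p x \<partial>\<rho>) \<le> C * Z + K * Z * (\<integral>x. ?p x \<partial>\<rho>)"
        using Z_ge K by (intro add_left_mono mult_right_mono mult_left_mono) auto
      finally have "(\<integral>x. ?g x \<partial>\<rho>) \<le> (C + K * (\<integral>x. ?p x \<partial>\<rho>)) * Z"
        by (simp add: algebra_simps)
      then show ?thesis using Z by (simp add: X(2) E pos_divide_le_eq)
    qed
  qed
  let ?S = "SUP v\<in>sphere 0 1. expect_pos_part \<rho> xs v"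
  have "ereal (norm (?X - xs)) \<le> ereal C + ereal K * ?S"
  proof (cases "?X = xs")
    case True
    \<comment> \<open>Only nonnegativity of the right-hand side is left. The sphere must be seen to
      be nonempty, since an empty supremum in \<open>ereal\<close> is minus infinity.\<close>
    obtain b :: "real ^ 'd" where "b \<in> sphere 0 1"
      using vector_choose_size[of 1] by auto
    then have "0 \<le> ?S" by (rule SUP_upper2) (rule expect_pos_part_nonneg)
    then have "0 \<le> ereal C + ereal K * ?S"
      using C K by (intro add_nonneg_nonneg ereal_0_le_mult) auto
    then show ?thesis using True by (simp add: zero_ereal_def[symmetric])
  next
    case False
    \<comment> \<open>In the direction of the displacement itself, the inner product equals the
      norm.\<close>
    define v where "v = sgn (?X - xs)"
    have v: "norm v = 1" using False by (simp add: v_def norm_sgn)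
    have "v \<bullet> (?X - xs) = norm (?X - xs)"
      using False by (simp add: v_def sgn_div_norm power2_norm_eq_inner[symmetric] power2_eq_square)
    then have "ereal (norm (?X - xs)) \<le> ereal C + ereal K * expect_pos_part \<rho> xs v"
      using main[OF v] by simp
    also have "\<dots> \<le> ereal C + ereal K * ?S"
      using v K by (intro add_left_mono ereal_mult_left_mono SUP_upper) auto
    finally show ?thesis .
  qed
  with main show ?thesis unfolding C_def K_def F_def m_def by simp
qed

end
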